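(* Let $\mathbb G$ be an affine group scheme of finite type over $k$ and consider two closed embeddings $\phi: \mathbb G \hookrightarrow GL_N$ and $\phi': \mathbb G \hookrightarrow GL_{N'}$. There exist positive integers $c, c'$ such that $$\mathcal O(\mathbb G)_{\leq d,\phi} \subset \mathcal O(\mathbb G)_{\leq c\cdot d,\phi'}, \qquad \mathcal O(\mathbb G)_{\leq d,\phi'} \subset \mathcal O(\mathbb G)_{\leq c'\cdot d,\phi}$$ for all $d \geq 0$.
   Context: $k$ is a field of characteristic $p>0$; $\mathcal O(-)$ denotes the coordinate algebra. A closed embedding of affine group schemes is a closed immersion which is a morphism of group schemes. Let $\mathbb M_{N,N}$ be the monoid scheme of $N\times N$ matrices, with $\mathcal O(\mathbb M_{N,N})$ the polynomial algebra in the $N^2$ variables $x_{i,j}$, and let $\mathcal O(\mathbb M_{N,N})_{\leq r}$ be the subspace of polynomials of total degree $\leq r$. Let $\mathcal O(\mathbb G_m)=k[t,t^{-1}]$ and let $\mathcal O(\mathbb G_m)_{\leq s}$ be the span of $\{t^i : N\cdot|i|\leq s\}$. Give $\mathcal O(\mathbb M_{N,N}\times\mathbb G_m)=\mathcal O(\mathbb M_{N,N})\otimes\mathcal O(\mathbb G_m)$ the tensor product filtration, $\mathcal O(\mathbb M_{N,N}\times\mathbb G_m)_{\leq d}=\sum_{r+s=d}\mathcal O(\mathbb M_{N,N})_{\leq r}\otimes\mathcal O(\mathbb G_m)_{\leq s}$. Let $\eta:GL_N\hookrightarrow\mathbb M_{N,N}\times\mathbb G_m$ be the closed immersion $A\mapsto(A,\det(A)^{-1})$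 and set $\mathcal O(GL_N)_{\leq d}=\eta^*(\mathcal O(\mathbb M_{N,N}\times\mathbb G_m)_{\leq d})$. For a closed embedding $\phi:\mathbb G\hookrightarrow GL_N$ set $\mathcal O(\mathbb G)_{\leq d,\phi}=\phi^*(\mathcal O(GL_N)_{\leq d})$. *)

theory Defs
  imports "HOL-Analysis.Analysis" "HOL-Library.Poly_Mapping"
    "HOL-Computational_Algebra.Polynomial"
begin

section \<open>Free modules and monoid algebras\<close>

text \<open>
  For a type \<open>'x\<close> of basis elements, \<open>'x \<Rightarrow>\<^sub>0 'k\<close> is the free \<open>'k\<close>-module on \<open>'x\<close>; if \<open>'x\<close> is a
  commutative (additively written) monoid, it is the commutative monoid algebra.
\<close>

definition free_scale :: "'k::field \<Rightarrow> ('x \<Rightarrow>\<^sub>0 'k) \<Rightarrow> ('x \<Rightarrow>\<^sub>0 'k)" where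
  "free_scale c u = Poly_Mapping.map ((*) c) u"

abbreviation free_span :: "('x \<Rightarrow>\<^sub>0 'k::field) set \<Rightarrow> ('x \<Rightarrow>\<^sub>0 'k) set" where
  "free_span \<equiv> module.span free_scale"

definition lin_ext ::
  "('k::field \<Rightarrow> 'b \<Rightarrow> 'b::comm_monoid_add) \<Rightarrow> ('x \<Rightarrow> 'b) \<Rightarrow> ('x \<Rightarrow>\<^sub>0 'k) \<Rightarrow> 'b" where
  "lin_ext s h u = (\<Sum>x\<in>Poly_Mapping.keys u. s (Poly_Mapping.lookup u x) (h x))"

section \<open>Commutative algebras over a field\<close>

locale comm_algebra = vector_space scale
  for scale :: "'k::field \<Rightarrow> 'a::comm_ring_1 \<Rightarrow> 'a" +
  assumes scale_mult: "scale c (x * y) = scale c x * y"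

definition finitely_generated :: "('k::field \<Rightarrow> 'a::comm_ring_1 \<Rightarrow> 'a) \<Rightarrow> bool" where
  "finitely_generated s \<longleftrightarrow>
     (\<exists>X. finite X \<and> module.span s {prod_list xs |xs. set xs \<subseteq> X} = UNIV)"

definition algebra_hom ::
  "('k::field \<Rightarrow> 'a::comm_ring_1 \<Rightarrow> 'a) \<Rightarrow> ('k \<Rightarrow> 'b::comm_ring_1 \<Rightarrow> 'b) \<Rightarrow> ('a \<Rightarrow> 'b) \<Rightarrow> bool" where
  "algebra_hom sA sB f \<longleftrightarrow>
     Vector_Spaces.linear sA sB f \<and> f 1 = 1 \<and> (\<forall>x y. f (x * y) = f x * f y)"

section \<open>Tensor products\<close>

text \<open>
  The tensor product of algebras \<open>A\<close> and \<open>B\<close> over \<open>'k\<close> is the quotient of the monoid algebra of the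
  multiplicative monoid \<open>A \<times> B\<close> by the subspace \<open>tensor_null\<close> spanned by the bilinearity
  relations. The scalar multiplications are values and not part of the types, so this quotient is
  not a type. Elements of the tensor product are given by representatives in the monoid algebra,
  and two of them are equal in the tensor product iff their difference is in \<open>tensor_null\<close>.

  The product on \<open>'x \<Rightarrow>\<^sub>0 'k\<close> extends the addition of \<open>'x\<close>. Hence \<open>+\<close> on the type \<open>pure_tensor\<close> is
  the componentwise multiplication, and \<open>0\<close> is the pair of units.
\<close>

datatype ('a, 'b) pure_tensor = Pure 'a 'b

instantiation pure_tensor :: (comm_monoid_mult, comm_monoid_mult) comm_monoid_add
begin

definition zero_pure_tensor :: "('a, 'b) pure_tensor" where
  "0 = Pure 1 1"

fun plus_pure_tensor :: "('a, 'b) pure_tensor \<Rightarrow> ('a, 'b) pure_tensor \<Rightarrow> ('a, 'b) pure_tensor" where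
  "Pure a b + Pure c d = Pure (a * c) (b * d)"

instance
proof
  fix x y z :: "('a, 'b) pure_tensor"
  show "x + y + z = x + (y + z)"
    by (cases x; cases y; cases z) (simp add: mult.assoc)
  show "x + y = y + x"
    by (cases x; cases y) (simp add: mult.commute)
  show "0 + x = x"
    by (cases x) (simp add: zero_pure_tensor_def)
qed

end

type_synonym ('k, 'a, 'b) tensor = "('a, 'b) pure_tensor \<Rightarrow>\<^sub>0 'k"

definition tens :: "'a \<Rightarrow> 'b \<Rightarrow> ('k::field, 'a, 'b) tensor" where
  "tens a b = Poly_Mapping.single (Pure a b) 1"

definition tensor_null ::
  "('k::field \<Rightarrow> 'a::comm_ring_1 \<Rightarrow> 'a) \<Rightarrow> ('k \<Rightarrow> 'b::comm_ring_1 \<Rightarrow> 'b) \<Rightarrow> ('k, 'a, 'b) tensor set" where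
  "tensor_null sA sB = free_span
     ({tens (a + a') b - tens a b - tens a' b |a a' b. True}
      \<union> {tens a (b + b') - tens a b - tens a b' |a b b'. True}
      \<union> {tens (sA c a) b - free_scale c (tens a b) |c a b. True}
      \<union> {tens a (sB c b) - free_scale c (tens a b) |c a b. True})"

definition tens3 :: "'a \<Rightarrow> 'b \<Rightarrow> 'c \<Rightarrow> ('a \<times> 'b \<times> 'c) \<Rightarrow>\<^sub>0 'k::field" where
  "tens3 a b c = Poly_Mapping.single (a, b, c) 1"

definition tensor3_null ::
  "('k::field \<Rightarrow> 'a::comm_ring_1 \<Rightarrow> 'a) \<Rightarrow> (('a \<times> 'a \<times> 'a) \<Rightarrow>\<^sub>0 'k) set" where
  "tensor3_null s = free_span
     ({tens3 (x + x') y z - tens3 x y z - tens3 x' y z |x x' y z. True}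
      \<union> {tens3 x (y + y') z - tens3 x y z - tens3 x y' z |x y y' z. True}
      \<union> {tens3 x y (z + z') - tens3 x y z - tens3 x y z' |x y z z'. True}
      \<union> {tens3 (s c x) y z - free_scale c (tens3 x y z) |c x y z. True}
      \<union> {tens3 x (s c y) z - free_scale c (tens3 x y z) |c x y z. True}
      \<union> {tens3 x y (s c z) - free_scale c (tens3 x y z) |c x y z. True})"

definition tensor_lift ::
  "('k::field \<Rightarrow> 'c::comm_monoid_add \<Rightarrow> 'c) \<Rightarrow> ('a \<Rightarrow> 'b \<Rightarrow> 'c) \<Rightarrow> ('k, 'a, 'b) tensor \<Rightarrow> 'c" where
  "tensor_lift s h = lin_ext s (case_pure_tensor h)"

definition tensor_map ::
  "('a \<Rightarrow> 'c) \<Rightarrow> ('b \<Rightarrow> 'd) \<Rightarrow> ('k::field, 'a, 'b) tensor \<Rightarrow> ('k, 'c, 'd) tensor" where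
  "tensor_map f g = tensor_lift free_scale (\<lambda>a b. tens (f a) (g b))"

section \<open>Affine group schemes\<close>

text \<open>
  An affine group scheme \<open>G\<close> over \<open>'k\<close> is given by its coordinate algebra, a commutative Hopf algebra:
  multiplication, unit and inverse of \<open>G\<close> are the comultiplication, counit and antipode.
  The coordinate algebra \<open>'a\<close> has its ring structure from the type class.
  The comultiplication takes values in representatives of elements of the tensor square.
\<close>

record (overloaded) ('k, 'a) group_scheme =
  scal :: "'k \<Rightarrow> 'a \<Rightarrow> 'a"
  comul :: "'a \<Rightarrow> ('k, 'a, 'a) tensor"
  counit :: "'a \<Rightarrow> 'k"
  antipode :: "'a \<Rightarrow> 'a"

definition tensor_eq ::
  "('k::field, 'a::comm_ring_1) group_scheme \<Rightarrow> ('k, 'a, 'a) tensor \<Rightarrow> ('k, 'a, 'a) tensor \<Rightarrow> bool" where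
  "tensor_eq G u v \<longleftrightarrow> u - v \<in> tensor_null (scal G) (scal G)"

locale affine_group_scheme =
  fixes G :: "('k::field, 'a::comm_ring_1) group_scheme"
  assumes algebra: "comm_algebra (scal G)"
    and comul_add: "tensor_eq G (comul G (x + y)) (comul G x + comul G y)"
    and comul_scal: "tensor_eq G (comul G (scal G c x)) (free_scale c (comul G x))"
    and comul_one: "tensor_eq G (comul G 1) 1"
    and comul_mult: "tensor_eq G (comul G (x * y)) (comul G x * comul G y)"
    and counit: "algebra_hom (scal G) (*) (counit G)"
    and antipode: "algebra_hom (scal G) (scal G) (antipode G)"
    and coassoc:
      "tensor_lift free_scale (\<lambda>a b. tensor_lift free_scale (\<lambda>a1 a2. tens3 a1 a2 b) (comul G a)) (comul G x)
       - tensor_lift free_scale (\<lambda>a b. tensor_lift free_scale (\<lambda>b1 b2. tens3 a b1 b2) (comul G b)) (comul G x)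
       \<in> tensor3_null (scal G)"
    and counit_left: "tensor_lift (scal G) (\<lambda>a b. scal G (counit G a) b) (comul G x) = x"
    and counit_right: "tensor_lift (scal G) (\<lambda>a b. scal G (counit G b) a) (comul G x) = x"
    and antipode_left: "tensor_lift (scal G) (\<lambda>a b. antipode G a * b) (comul G x) = scal G (counit G x) 1"
    and antipode_right: "tensor_lift (scal G) (\<lambda>a b. a * antipode G b) (comul G x) = scal G (counit G x) 1"

definition finite_type :: "('k::field, 'a::comm_ring_1) group_scheme \<Rightarrow> bool" where
  "finite_type G \<longleftrightarrow> finitely_generated (scal G)"

text \<open>
  Morphisms of schemes are given by their comorphisms; so a morphism from \<open>G\<close> to \<open>H\<close> is a map from
  the coordinate algebra of \<open>H\<close> to that of \<open>G\<close>.
\<close>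

definition group_scheme_morphism ::
  "('k::field, 'a::comm_ring_1) group_scheme \<Rightarrow> ('k, 'b::comm_ring_1) group_scheme \<Rightarrow> ('b \<Rightarrow> 'a) \<Rightarrow> bool" where
  "group_scheme_morphism G H f \<longleftrightarrow>
     algebra_hom (scal H) (scal G) f \<and>
     (\<forall>x. tensor_eq G (tensor_map f f (comul H x)) (comul G (f x)))"

definition closed_embedding ::
  "('k::field, 'a::comm_ring_1) group_scheme \<Rightarrow> ('k, 'b::comm_ring_1) group_scheme \<Rightarrow> ('b \<Rightarrow> 'a) \<Rightarrow> bool" where
  "closed_embedding G H f \<longleftrightarrow> group_scheme_morphism G H f \<and> surj f"

section \<open>The schemes of matrices and of units\<close>

text \<open>The variable \<open>x\<^bsub>i,j\<^esub>\<close> of the polynomial algebra has the index \<open>(i, j)\<close>, and \<open>N = CARD('n)\<close>.\<close>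

type_synonym ('k, 'n) mat_coord = "(('n \<times> 'n) \<Rightarrow>\<^sub>0 nat) \<Rightarrow>\<^sub>0 'k"

definition mat_var :: "'n \<Rightarrow> 'n \<Rightarrow> ('k::field, 'n) mat_coord" where
  "mat_var i j = Poly_Mapping.single (Poly_Mapping.single (i, j) 1) 1"

definition generic_det :: "('k::field, 'n::finite) mat_coord" where
  "generic_det = det (\<chi> i j. mat_var i j)"

definition mat_filt :: "nat \<Rightarrow> ('k::field, 'n::finite) mat_coord set" where
  "mat_filt r = {f. \<forall>m\<in>Poly_Mapping.keys f. (\<Sum>v\<in>UNIV. Poly_Mapping.lookup m v) \<le> r}"

definition mat_eval ::
  "('k::field \<Rightarrow> 'b::comm_ring_1 \<Rightarrow> 'b) \<Rightarrow> ('n::finite \<Rightarrow> 'n \<Rightarrow> 'b) \<Rightarrow> ('k, 'n) mat_coord \<Rightarrow> 'b" where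
  "mat_eval s X = lin_ext s (\<lambda>m. \<Prod>(i, j)\<in>UNIV. X i j ^ Poly_Mapping.lookup m (i, j))"

type_synonym 'k gm_coord = "int \<Rightarrow>\<^sub>0 'k"

definition gm_filt :: "nat \<Rightarrow> nat \<Rightarrow> 'k::field gm_coord set" where
  "gm_filt N s = free_span {Poly_Mapping.single i 1 |i. int N * \<bar>i\<bar> \<le> int s}"

text \<open>The set of all representatives of elements of the filtered piece of the tensor product.\<close>

definition mat_gm_filt :: "nat \<Rightarrow> ('k::field, ('k, 'n::finite) mat_coord, 'k gm_coord) tensor set" where
  "mat_gm_filt d = free_span
     ({tens f g |f g r s. r + s = d \<and> f \<in> mat_filt r \<and> g \<in> gm_filt CARD('n) s}
      \<union> tensor_null free_scale free_scale)"

section \<open>Evaluation homomorphisms\<close>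

lemma free_scale_single [simp]:
  "free_scale c (Poly_Mapping.single x a) = Poly_Mapping.single x (c * a)"
  by (rule poly_mapping_eqI)
    (simp add: free_scale_def Poly_Mapping.map.rep_eq lookup_single when_def)

lemma lookup_free_scale [simp]:
  "Poly_Mapping.lookup (free_scale c u) x = c * Poly_Mapping.lookup u x"
  by (simp add: free_scale_def Poly_Mapping.map.rep_eq when_def)

lemma free_scale_vector_space: "vector_space free_scale"
  by unfold_locales (auto intro!: poly_mapping_eqI simp: lookup_add algebra_simps)

lemma poly_mapping_eq_sum_single:
  "u = (\<Sum>x\<in>Poly_Mapping.keys u. Poly_Mapping.single x (Poly_Mapping.lookup u x))"
  by (rule poly_mapping_eqI)
    (auto simp: lookup_sum lookup_single when_def sum.delta' in_keys_iff)

lemma (in vector_space) lin_ext_superset: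
  assumes "finite A" "Poly_Mapping.keys u \<subseteq> A"
  shows "lin_ext scale h u = (\<Sum>x\<in>A. scale (Poly_Mapping.lookup u x) (h x))"
  unfolding lin_ext_def
  using assms by (intro sum.mono_neutral_left) (auto simp: in_keys_iff)

lemma (in vector_space) lin_ext_single [simp]:
  "lin_ext scale h (Poly_Mapping.single x a) = scale a (h x)"
  by (simp add: lin_ext_superset[of "{x}"])

lemma (in vector_space) lin_ext_add:
  "lin_ext scale h (u + v) = lin_ext scale h u + lin_ext scale h v"
proof -
  let ?A = "Poly_Mapping.keys u \<union> Poly_Mapping.keys v"
  have "Poly_Mapping.keys (u + v) \<subseteq> ?A"
    by (rule Poly_Mapping.keys_add)
  then show ?thesis
    by (simp add: lin_ext_superset[of ?A] lookup_add scale_left_distrib sum.distrib)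
qed

lemma (in vector_space) lin_ext_sum:
  "lin_ext scale h (\<Sum>i\<in>I. u i) = (\<Sum>i\<in>I. lin_ext scale h (u i))"
proof (induction I rule: infinite_finite_induct)
  case empty
  then show ?case by (simp add: lin_ext_def)
qed (simp_all add: lin_ext_add, simp add: lin_ext_def)

lemma (in comm_algebra) lin_ext_mult:
  fixes h :: "'x::comm_monoid_add \<Rightarrow> 'a"
  assumes "\<And>x y. h (x + y) = h x * h y"
  shows "lin_ext scale h (u * v) = lin_ext scale h u * lin_ext scale h v"
proof -
  let ?l = Poly_Mapping.lookup and ?s = Poly_Mapping.single
  have scale2: "scale a x * scale b y = scale (a * b) (x * y)" for a b x y
    by (metis mult.commute scale_mult scale_scale)
  have "u * v = (\<Sum>x\<in>Poly_Mapping.keys u. ?s x (?l u x)) * (\<Sum>y\<in>Poly_Mapping.keys v. ?s y (?l v y))"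
    by (simp only: poly_mapping_eq_sum_single[symmetric])
  also have "\<dots> = (\<Sum>x\<in>Poly_Mapping.keys u. \<Sum>y\<in>Poly_Mapping.keys v. ?s (x + y) (?l u x * ?l v y))"
    by (simp add: sum_product Poly_Mapping.mult_single)
  finally have "lin_ext scale h (u * v) =
      (\<Sum>x\<in>Poly_Mapping.keys u. \<Sum>y\<in>Poly_Mapping.keys v. scale (?l u x * ?l v y) (h x * h y))"
    by (simp add: lin_ext_sum assms)
  also have "\<dots> = lin_ext scale h u * lin_ext scale h v"
    by (simp add: lin_ext_def sum_product scale2)
  finally show ?thesis .
qed

lemma comm_algebra_self: "comm_algebra ((*) :: 'k::field \<Rightarrow> 'k \<Rightarrow> 'k)"
  by unfold_locales (simp_all add: algebra_simps)

lemma (in comm_algebra) mat_eval_hom: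
  "mat_eval scale X 1 = 1"
  "mat_eval scale X (p + q) = mat_eval scale X p + mat_eval scale X q"
  "mat_eval scale X (p * q) = mat_eval scale X p * mat_eval scale X q"
  unfolding mat_eval_def
    apply (simp flip: Poly_Mapping.single_one)
   apply (rule lin_ext_add)
  apply (rule lin_ext_mult)
  apply (simp add: lookup_add power_add prod.distrib case_prod_beta)
  done

lemma (in comm_algebra) mat_eval_var [simp]: "mat_eval scale X (mat_var i j) = X (i :: 'n::finite) j"
proof -
  have "(\<Prod>(a, b)\<in>UNIV. X a b ^ Poly_Mapping.lookup (Poly_Mapping.single (i, j) (1::nat)) (a, b))
      = (\<Prod>v\<in>UNIV. if v = (i, j) then X i j else 1)"
  proof (rule prod.cong)
    fix v :: "'n \<times> 'n"
    show "(case v of (a, b) \<Rightarrow> X a b ^ Poly_Mapping.lookup (Poly_Mapping.single (i, j) 1) (a, b))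
        = (if v = (i, j) then X i j else 1)"
      by (cases "v = (i, j)") (simp_all add: case_prod_beta lookup_single_not_eq)
  qed simp
  then show ?thesis
    by (simp add: mat_eval_def mat_var_def)
qed

lemma (in comm_algebra) mat_eval_det:
  "mat_eval scale X (generic_det :: (_, 'n::finite) mat_coord) = det (\<chi> i j. X i j)"
proof -
  let ?e = "mat_eval scale X"
  have zero: "?e 0 = 0"
    by (simp add: mat_eval_def lin_ext_def)
  have neg: "?e (- p) = - ?e p" for p
    using mat_eval_hom(2)[of X p "- p"] zero by (simp add: add_eq_0_iff)
  have sum: "?e (sum f A) = (\<Sum>a\<in>A. ?e (f a))" if "finite A" for f and A :: "('n \<Rightarrow> 'n) set"
    using that by induction (simp_all add: zero mat_eval_hom)
  have prod: "?e (prod f A) = (\<Prod>a\<in>A. ?e (f a))" for f and A :: "'n set"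
    by (induction A rule: infinite_finite_induct) (simp_all add: mat_eval_hom)
  have "?e (of_int (sign p)) = of_int (sign p)" for p :: "'n \<Rightarrow> 'n"
    by (simp add: sign_def neg mat_eval_hom)
  then show ?thesis
    by (simp add: generic_det_def det_def sum prod mat_eval_hom)
qed

section \<open>The general linear group\<close>

text \<open>
  The coordinate algebra of the general linear group is the localization of the polynomial algebra
  in the variables \<open>x\<^bsub>i,j\<^esub>\<close> at the determinant, i.e. the quotient of the polynomial ring in one
  further variable \<open>t\<close> over it by the ideal generated by \<open>t \<cdot> det - 1\<close>.
\<close>

quotient_type (overloaded) ('k, 'n) gl_coord = "('k::field, 'n::finite) mat_coord poly" /
  "\<lambda>p q. [:- 1, generic_det:] dvd p - q"
  morphisms rep_gl_coord abs_gl_coord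
proof (rule equivpI)
  let ?R = "\<lambda>p q :: ('k, 'n) mat_coord poly. [:- 1, generic_det:] dvd p - q"
  show "reflp ?R"
    by (simp add: reflp_def)
  show "symp ?R"
  proof (rule sympI)
    show "?R q p" if "?R p q" for p q
      using that dvd_minus_iff[of _ "p - q"] by simp
  qed
  show "transp ?R"
  proof (rule transpI)
    show "?R p r" if "?R p q" "?R q r" for p q r
      using dvd_add[OF that] by simp
  qed
qed

instantiation gl_coord :: (field, finite) comm_ring_1
begin

lift_definition zero_gl_coord :: "('a, 'b) gl_coord" is 0 .

lift_definition one_gl_coord :: "('a, 'b) gl_coord" is 1 .

lift_definition plus_gl_coord :: "('a, 'b) gl_coord \<Rightarrow> ('a, 'b) gl_coord \<Rightarrow> ('a, 'b) gl_coord" is "(+)"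
  by (simp add: add_diff_add)

lift_definition uminus_gl_coord :: "('a, 'b) gl_coord \<Rightarrow> ('a, 'b) gl_coord" is uminus
  by (metis dvd_minus_iff minus_diff_minus)

lift_definition minus_gl_coord :: "('a, 'b) gl_coord \<Rightarrow> ('a, 'b) gl_coord \<Rightarrow> ('a, 'b) gl_coord" is "(-)"
  subgoal for p p' q q' using dvd_diff[of _ "p - p'" "q - q'"] by (simp add: algebra_simps)
  done

lift_definition times_gl_coord :: "('a, 'b) gl_coord \<Rightarrow> ('a, 'b) gl_coord \<Rightarrow> ('a, 'b) gl_coord" is "(*)"
  subgoal for p p' q q'
    using dvd_add[OF dvd_mult[of _ "q - q'" p] dvd_mult2[of _ "p - p'" q']] by (simp add: algebra_simps)
  done

instance
proof
  fix a b c :: "('a, 'b) gl_coord"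
  show "a * b * c = a * (b * c)" "a * b = b * a" "1 * a = a" "a + b + c = a + (b + c)"
    "a + b = b + a" "0 + a = a" "- a + a = 0" "a - b = a + - b" "(a + b) * c = a * c + b * c"
    by (transfer, simp add: algebra_simps)+
  show "0 \<noteq> (1 :: ('a, 'b) gl_coord)"
  proof transfer
    interpret comm_algebra "(*) :: 'a \<Rightarrow> 'a \<Rightarrow> 'a"
      by (rule comm_algebra_self)
    define e :: "('a, 'b) mat_coord \<Rightarrow> 'a" where
      "e = mat_eval (*) (\<lambda>i j. if i = j then 1 else 0)"
    have e0: "e 0 = 0"
      by (simp add: e_def mat_eval_def lin_ext_def)
    have e1: "e 1 = 1" and eadd: "e (p + q) = e p + e q" and emult: "e (p * q) = e p * e q" for p q
      unfolding e_def by (rule mat_eval_hom)+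
    have "e generic_det = det (mat 1 :: 'a^'b^'b)"
      by (simp add: e_def mat_eval_det mat_def)
    then have edet: "e generic_det = 1"
      by simp
    show "\<not> [:- 1, generic_det:] dvd 0 - (1 :: ('a, 'b) mat_coord poly)"
    proof
      assume "[:- 1, generic_det:] dvd 0 - (1 :: ('a, 'b) mat_coord poly)"
      then obtain r :: "('a, 'b) mat_coord poly" where r: "- 1 = [:- 1, generic_det:] * r"
        unfolding dvd_def diff_0 by blast
      have r0: "coeff r 0 = 1"
        using arg_cong[OF r, of "\<lambda>p. coeff p 0"] by simp
      have rS: "coeff r (Suc n) = generic_det * coeff r n" for n
        using arg_cong[OF r, of "\<lambda>p. coeff p (Suc n)"]
        by simp
      have "e (coeff r n) = 1" for n
        by (induction n) (simp_all add: r0 rS e1 emult edet)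
      moreover have "coeff r (Suc (Polynomial.degree r)) = 0"
        by (simp add: coeff_eq_0)
      ultimately show False
        using e0 by (metis zero_neq_one)
    qed
  qed
qed

end

lift_definition gl_scale :: "'k::field \<Rightarrow> ('k, 'n::finite) gl_coord \<Rightarrow> ('k, 'n) gl_coord"
  is "\<lambda>c p. [:Poly_Mapping.single 0 c:] * p"
  by (metis dvd_mult right_diff_distrib)

definition gl_of_mat :: "('k::field, 'n::finite) mat_coord \<Rightarrow> ('k, 'n) gl_coord" where
  "gl_of_mat f = abs_gl_coord [:f:]"

definition gl_det_inv :: "('k::field, 'n::finite) gl_coord" where
  "gl_det_inv = abs_gl_coord [:0, 1:]"

abbreviation gl_var :: "'n \<Rightarrow> 'n \<Rightarrow> ('k::field, 'n::finite) gl_coord" where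
  "gl_var i j \<equiv> gl_of_mat (mat_var i j)"

text \<open>
  Evaluation of \<open>f\<close> at \<open>x\<^bsub>i,j\<^esub> = X i j\<close> and \<open>1 / det = t\<close>. It uses a representative of \<open>f\<close>, and
  does not depend on it if \<open>t\<close> is inverse to the determinant of \<open>X\<close>. In the comultiplication below
  \<open>t\<close> is inverse to that determinant modulo \<open>tensor_null\<close> only, so there the value is determined
  modulo \<open>tensor_null\<close>, i.e. as an element of the tensor product.
\<close>

definition gl_eval ::
  "('k::field \<Rightarrow> 'b::comm_ring_1 \<Rightarrow> 'b) \<Rightarrow> ('n::finite \<Rightarrow> 'n \<Rightarrow> 'b) \<Rightarrow> 'b \<Rightarrow> ('k, 'n) gl_coord \<Rightarrow> 'b" where
  "gl_eval s X t f = poly (map_poly (mat_eval s X) (rep_gl_coord f)) t"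

text \<open>
  The comultiplication is \<open>x\<^bsub>i,j\<^esub> \<mapsto> \<Sum>\<^sub>l x\<^bsub>i,l\<^esub> \<otimes> x\<^bsub>l,j\<^esub>\<close>. The determinant in the antipode is the \<open>(i, j)\<close>
  entry of the adjugate matrix.
\<close>

definition GL :: "('k::field, ('k, 'n::finite) gl_coord) group_scheme" where
  "GL = \<lparr>scal = gl_scale,
     comul = gl_eval free_scale (\<lambda>i j. \<Sum>l\<in>UNIV. tens (gl_var i l) (gl_var l j)) (tens gl_det_inv gl_det_inv),
     counit = gl_eval (*) (\<lambda>i j. if i = j then 1 else 0) 1,
     antipode = gl_eval gl_scale
       (\<lambda>i j. gl_det_inv * det (\<chi> r c. if r = j then (if c = i then 1 else 0) else gl_var r c))
       (gl_of_mat generic_det)\<rparr>"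

definition gm_eval ::
  "('k::field \<Rightarrow> 'b::comm_ring_1 \<Rightarrow> 'b) \<Rightarrow> 'b \<Rightarrow> 'b \<Rightarrow> 'k gm_coord \<Rightarrow> 'b" where
  "gm_eval s t t_inv = lin_ext s (\<lambda>i. if i \<ge> 0 then t ^ nat i else t_inv ^ nat (- i))"

text \<open>The comorphism of the closed immersion \<open>A \<mapsto> (A, 1 / det A)\<close>.\<close>

definition eta :: "('k::field, ('k, 'n::finite) mat_coord, 'k gm_coord) tensor \<Rightarrow> ('k, 'n) gl_coord" where
  "eta = tensor_lift gl_scale
     (\<lambda>f g. gl_of_mat f * gm_eval gl_scale gl_det_inv (gl_of_mat generic_det) g)"

definition gl_filt :: "nat \<Rightarrow> ('k::field, 'n::finite) gl_coord set" where
  "gl_filt d = eta ` mat_gm_filt d"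

definition emb_filt :: "(('k::field, 'n::finite) gl_coord \<Rightarrow> 'a::comm_ring_1) \<Rightarrow> nat \<Rightarrow> 'a set" where
  "emb_filt \<phi> d = \<phi> ` gl_filt d"

end

theory Submission
  imports Defs
begin

text \<open>
  The filtration of \<open>\<O>(G)\<close> attached to an embedding is multiplicative, and it is exhaustive because
  the comorphism of the embedding is surjective (\<open>algebra_filtration_emb_filt\<close>). On the other hand
  \<open>\<O>(GL\<^sub>N)\<close> has the finitely many generators \<open>x\<^bsub>i,j\<^esub>\<close>, \<open>det\<close> and \<open>1 / det\<close>, and the piece of degree \<open>d\<close>
  of its filtration is spanned by certain monomials in at most \<open>d\<close> of them. Given two embeddings
  \<open>\<phi>\<close> and \<open>\<phi>'\<close>, exhaustiveness puts the images under \<open>\<phi>\<close> of all generators in one piece of the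
  filtration of \<open>\<phi>'\<close>, say that of degree \<open>c\<close>. A product of at most \<open>d\<close> of them then lies in the piece
  of degree \<open>c \<cdot> d\<close> (\<open>emb_filt_subset_of_generators\<close>), and exchanging the embeddings gives the
  other inclusion.

  The filtration of \<open>\<O>(GL\<^sub>N)\<close> is defined by representatives in a tensor product. The map \<open>eta\<close> is
  linear and kills the bilinearity relations, so that its image is the span of the products
  \<open>f \<cdot> g\<close> with \<open>f\<close> a polynomial in the entries and \<open>g\<close> a Laurent polynomial in \<open>1 / det\<close>
  (\<open>gl_filt_eq_span\<close>). Everything else is done with these products.
\<close>

section \<open>Multiplicative filtrations\<close>

locale algebra_filtration = comm_algebra scale
  for scale :: "'k::field \<Rightarrow> 'a::comm_ring_1 \<Rightarrow> 'a" +
  fixes E :: "nat \<Rightarrow> 'a set"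
  assumes subspace_filt: "subspace (E d)"
    and filt_mono: "d \<le> e \<Longrightarrow> E d \<subseteq> E e"
    and one_filt: "1 \<in> E 0"
    and mult_filt: "x \<in> E d \<Longrightarrow> y \<in> E e \<Longrightarrow> x * y \<in> E (d + e)"
    and exhaustive: "\<exists>d. x \<in> E d"
begin

lemma filt_monoD: "x \<in> E d \<Longrightarrow> d \<le> e \<Longrightarrow> x \<in> E e"
  using filt_mono by blast

lemma power_filt:
  assumes "x \<in> E c"
  shows "x ^ n \<in> E (c * n)"
proof (induction n)
  case 0
  then show ?case by (simp add: one_filt)
next
  case (Suc n)
  then show ?case using mult_filt[OF assms Suc] by simp
qed

text \<open>
  The degree is taken positive because it becomes the constant of the comparison.
\<close>

lemma finite_subset_filt:
  assumes "finite S"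
  shows "\<exists>c>0. S \<subseteq> E c"
proof -
  obtain d where d: "\<And>x. x \<in> E (d x)"
    using exhaustive by metis
  define c where "c = Suc (\<Sum>x\<in>S. d x)"
  have "d x \<le> c" if "x \<in> S" for x
    using member_le_sum[of x S d] that assms by (simp add: c_def)
  then have "S \<subseteq> E c"
    using d filt_monoD by blast
  then show ?thesis
    by (auto simp: c_def)
qed

end

lemma (in comm_algebra) mult_scale: "x * scale c y = scale c (x * y)"
  using scale_mult[of c y x] by (simp add: mult.commute)

text \<open>
  This reduces multiplicativity of a filtration to products of spanning elements.
\<close>

lemma (in comm_algebra) span_mult:
  assumes "subspace U" and prod: "\<And>x y. x \<in> S \<Longrightarrow> y \<in> T \<Longrightarrow> x * y \<in> U"
    and "x \<in> span S" "y \<in> span T"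
  shows "x * y \<in> U"
proof -
  have sub: "subspace {x. x * y \<in> U}" "subspace {y. x * y \<in> U}" for x y
    using \<open>subspace U\<close>
    by (auto simp: subspace_def distrib_left distrib_right mult_scale simp flip: scale_mult)
  have "x * y \<in> U" if "x \<in> S" for x
    using \<open>y \<in> span T\<close> sub(2) by (rule span_induct) (simp add: prod that)
  then show ?thesis
    using \<open>x \<in> span S\<close> sub(1) by (auto elim!: span_induct)
qed

section \<open>The coordinate algebra of the general linear group\<close>

lemma (in vector_space) linear_lin_ext: "Vector_Spaces.linear free_scale scale (lin_ext scale h)"
proof -
  interpret free: vector_space "free_scale :: 'a \<Rightarrow> ('x \<Rightarrow>\<^sub>0 'a) \<Rightarrow> 'x \<Rightarrow>\<^sub>0 'a"
    by (rule free_scale_vector_space)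
  have "lin_ext scale h (free_scale c u) = scale c (lin_ext scale h u)" for c u
  proof -
    have "Poly_Mapping.keys (free_scale c u) \<subseteq> Poly_Mapping.keys u"
      by (auto simp: in_keys_iff)
    then show ?thesis
      by (simp add: lin_ext_superset[of "Poly_Mapping.keys u"] scale_sum_right)
  qed
  then show ?thesis
    by unfold_locales (simp_all add: lin_ext_add)
qed

lemma comm_algebra_gl_scale:
  "comm_algebra (gl_scale :: 'k::field \<Rightarrow> ('k, 'n::finite) gl_coord \<Rightarrow> _)"
proof
  fix a b :: 'k and x y :: "('k, 'n) gl_coord"
  show "gl_scale a (x + y) = gl_scale a x + gl_scale a y"
    by transfer (simp add: smult_add_right)
  show "gl_scale (a + b) x = gl_scale a x + gl_scale b x"
    by transfer (simp add: single_add smult_add_left)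
  show "gl_scale a (gl_scale b x) = gl_scale (a * b) x"
    by transfer (simp add: mult_single mult.commute)
  show "gl_scale 1 x = x"
    by transfer simp
  show "gl_scale a (x * y) = gl_scale a x * y"
    by transfer simp
qed

interpretation gl: comm_algebra "gl_scale :: 'k::field \<Rightarrow> ('k, 'n::finite) gl_coord \<Rightarrow> _"
  by (rule comm_algebra_gl_scale)

interpretation free: vector_space "free_scale :: 'k::field \<Rightarrow> ('x \<Rightarrow>\<^sub>0 'k) \<Rightarrow> _"
  by (rule free_scale_vector_space)

lemma gl_of_mat_add: "gl_of_mat (f + g) = gl_of_mat f + gl_of_mat g"
  by (simp add: gl_of_mat_def plus_gl_coord.abs_eq)

lemma gl_of_mat_mult: "gl_of_mat (f * g) = gl_of_mat f * gl_of_mat g"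
  by (simp add: gl_of_mat_def times_gl_coord.abs_eq mult.commute)

lemma gl_of_mat_1: "gl_of_mat 1 = 1"
  by (simp add: gl_of_mat_def one_gl_coord_def one_pCons)

lemma free_scale_eq_mult: "free_scale c f = Poly_Mapping.single 0 c * f"
  by (simp add: free_scale_def mult_map_scale_conv_mult)

lemma comm_algebra_free_scale:
  "comm_algebra (free_scale :: 'k::field \<Rightarrow> ('x::comm_monoid_add \<Rightarrow>\<^sub>0 'k) \<Rightarrow> _)"
  by unfold_locales (simp add: free_scale_eq_mult mult.assoc)

lemma gl_of_mat_scale: "gl_of_mat (free_scale c f) = gl_scale c (gl_of_mat f)"
  by (simp add: gl_of_mat_def gl_scale.abs_eq free_scale_eq_mult mult.commute)

interpretation gl_of_mat: Vector_Spaces.linear free_scale gl_scale gl_of_mat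
  by unfold_locales (simp_all add: gl_of_mat_add gl_of_mat_scale)

lemma gl_det_inv_mult_det: "gl_det_inv * gl_of_mat generic_det = 1"
  unfolding gl_det_inv_def gl_of_mat_def times_gl_coord.abs_eq one_gl_coord_def
  by (simp add: gl_coord.abs_eq_iff one_pCons)

text \<open>
  The function \<open>P\<close> gives the integer powers of the unit \<open>t\<close>: the product \<open>t\<^sup>a \<cdot> t'\<^sup>b\<close> depends on \<open>a - b\<close>
  only, and every \<open>P i\<close> has this form.
  This is what makes the evaluation of Laurent polynomials at \<open>1 / det\<close> multiplicative.
\<close>

lemma signed_power_add:
  fixes t t' :: "'a::comm_ring_1"
  defines "P \<equiv> \<lambda>i::int. if i \<ge> 0 then t ^ nat i else t' ^ nat (- i)"
  assumes inv: "t * t' = 1"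
  shows "P (i + j) = P i * P j"
proof -
  have diff: "t ^ a * t' ^ b = P (int a - int b)" for a b
  proof (cases "b \<le> a")
    case True
    then obtain k where "a = b + k" by (metis le_add_diff_inverse)
    moreover have "t ^ (b + k) * t' ^ b = (t * t') ^ b * t ^ k"
      by (simp add: power_add power_mult_distrib mult_ac)
    ultimately show ?thesis by (simp add: P_def inv)
  next
    case False
    then obtain k where "b = a + k" "k > 0" by (metis less_imp_add_positive not_le)
    moreover have "t ^ a * t' ^ (a + k) = (t * t') ^ a * t' ^ k"
      by (simp add: power_add power_mult_distrib mult_ac)
    ultimately show ?thesis by (simp add: P_def inv)
  qed
  have split: "P i = t ^ nat i * t' ^ nat (- i)" for i
    by (simp add: P_def)
  have "P i * P j = t ^ (nat i + nat j) * t' ^ (nat (- i) + nat (- j))"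
    by (simp add: split power_add mult_ac)
  also have "\<dots> = P (i + j)"
    unfolding diff by (rule arg_cong[of _ _ P]) simp
  finally show ?thesis by simp
qed

abbreviation gl_of_gm :: "'k::field gm_coord \<Rightarrow> ('k, 'n::finite) gl_coord" where
  "gl_of_gm \<equiv> gm_eval gl_scale gl_det_inv (gl_of_mat generic_det)"

interpretation gl_of_gm: Vector_Spaces.linear free_scale gl_scale gl_of_gm
  unfolding gm_eval_def by (rule gl.linear_lin_ext)

lemma gl_of_gm_mult: "gl_of_gm (f * g) = gl_of_gm f * gl_of_gm g"
  unfolding gm_eval_def
  by (rule gl.lin_ext_mult, rule signed_power_add, rule gl_det_inv_mult_det)

lemma gl_of_gm_single:
  "gl_of_gm (Poly_Mapping.single i 1) =
     (if i \<ge> 0 then gl_det_inv ^ nat i else gl_of_mat generic_det ^ nat (- i))"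
  by (simp add: gm_eval_def)

section \<open>The filtration of the general linear group\<close>

lemma mat_filt_mono: "r \<le> r' \<Longrightarrow> f \<in> mat_filt r \<Longrightarrow> f \<in> mat_filt r'"
  by (fastforce simp: mat_filt_def)

lemma one_mat_filt: "1 \<in> mat_filt 0"
  by (simp add: mat_filt_def flip: single_one)

lemma mat_filt_mult:
  assumes "f \<in> mat_filt r" "g \<in> mat_filt r'"
  shows "f * g \<in> mat_filt (r + r')"
  unfolding mat_filt_def
proof safe
  fix m assume "m \<in> Poly_Mapping.keys (f * g)"
  then obtain a b where "a \<in> Poly_Mapping.keys f" "b \<in> Poly_Mapping.keys g" "m = a + b"
    using keys_mult[of f g] by blast
  then show "(\<Sum>v\<in>UNIV. Poly_Mapping.lookup m v) \<le> r + r'"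
    using assms by (simp add: mat_filt_def lookup_add sum.distrib add_mono)
qed

lemma mat_filt_exhaustive: "\<exists>r. f \<in> mat_filt r"
proof -
  let ?deg = "\<lambda>m. \<Sum>v\<in>UNIV. Poly_Mapping.lookup m v"
  have "?deg m \<le> (\<Sum>m\<in>Poly_Mapping.keys f. ?deg m)" if "m \<in> Poly_Mapping.keys f" for m
    using that by (intro member_le_sum) auto
  then show ?thesis unfolding mat_filt_def by blast
qed

lemma gm_filt_mult:
  fixes f g :: "'k::field gm_coord"
  assumes "f \<in> gm_filt N s" "g \<in> gm_filt N s'"
  shows "f * g \<in> gm_filt N (s + s')"
proof -
  have bound: "int N * \<bar>i + j\<bar> \<le> int (s + s')" if "int N * \<bar>i\<bar> \<le> int s" "int N * \<bar>j\<bar> \<le> int s'" for i j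
  proof -
    have "int N * \<bar>i + j\<bar> \<le> int N * (\<bar>i\<bar> + \<bar>j\<bar>)"
      by (intro mult_left_mono abs_triangle_ineq) simp
    then show ?thesis using that by (simp add: algebra_simps)
  qed
  show ?thesis
    unfolding gm_filt_def
  proof (rule comm_algebra.span_mult[OF comm_algebra_free_scale free.subspace_span _ assms[unfolded gm_filt_def]])
    fix x y :: "'k gm_coord"
    assume "x \<in> {Poly_Mapping.single i 1 |i. int N * \<bar>i\<bar> \<le> int s}"
      and "y \<in> {Poly_Mapping.single i 1 |i. int N * \<bar>i\<bar> \<le> int s'}"
    then obtain i j where x: "x = Poly_Mapping.single i 1" "int N * \<bar>i\<bar> \<le> int s"
      and y: "y = Poly_Mapping.single j 1" "int N * \<bar>j\<bar> \<le> int s'"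
      by blast
    have "x * y = Poly_Mapping.single (i + j) 1"
      by (simp add: x y mult_single)
    then show "x * y \<in> free.span {Poly_Mapping.single i 1 |i. int N * \<bar>i\<bar> \<le> int (s + s')}"
      using bound[OF x(2) y(2)] by (intro free.span_base) blast
  qed
qed

lemma one_gm_filt: "1 \<in> gm_filt N 0"
  unfolding gm_filt_def by (rule free.span_base) (auto intro!: exI[of _ 0])

definition gl_filt_gens :: "nat \<Rightarrow> ('k::field, 'n::finite) gl_coord set" where
  "gl_filt_gens d =
     {gl_of_mat f * gl_of_gm g |f g r s. r + s = d \<and> f \<in> mat_filt r \<and> g \<in> gm_filt CARD('n) s}"

text \<open>
  The set of representatives \<open>mat_gm_filt d\<close> is a span that includes the bilinearity relations.
  Those are killed by \<open>eta\<close>, because \<open>gl_of_mat\<close> and \<open>gl_of_gm\<close> are linear and the product is bilinear,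
  so that only the images of the pure tensors remain.
\<close>

lemma gl_filt_eq_span: "(gl_filt d :: ('k::field, 'n::finite) gl_coord set) = gl.span (gl_filt_gens d)"
proof -
  interpret eta: Vector_Spaces.linear free_scale gl_scale "eta :: _ \<Rightarrow> ('k, 'n) gl_coord"
    unfolding eta_def tensor_lift_def by (rule gl.linear_lin_ext)
  have tens: "eta (tens f g) = gl_of_mat f * (gl_of_gm g :: ('k, 'n) gl_coord)" for f g
    by (simp add: eta_def tensor_lift_def tens_def)
  let ?null = "tensor_null free_scale free_scale :: ('k, ('k, 'n) mat_coord, 'k gm_coord) tensor set"
  have "eta u = 0" if "u \<in> ?null" for u
    using that unfolding tensor_null_def
  proof (rule free.span_induct)
    show "free.subspace {u. (eta u :: ('k, 'n) gl_coord) = 0}"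
      by (rule eta.subspace_kernel)
  qed (auto simp: eta.diff eta.scale tens gl_of_mat.add gl_of_mat.scale gl_of_gm.add gl_of_gm.scale
    gl.mult_scale distrib_left distrib_right simp flip: gl.scale_mult)
  moreover have "0 \<in> ?null"
    unfolding tensor_null_def by (rule free.span_zero)
  ultimately have null: "eta ` ?null = {0}"
    by (auto intro: image_eqI[of _ _ 0])
  let ?S = "{tens f g |f g r s. r + s = d \<and> f \<in> mat_filt r \<and> g \<in> gm_filt CARD('n) s}
    :: ('k, ('k, 'n) mat_coord, 'k gm_coord) tensor set"
  have "eta ` ?S = gl_filt_gens d"
  proof (intro set_eqI iffI)
    fix x :: "('k, 'n) gl_coord" assume "x \<in> eta ` ?S"
    then show "x \<in> gl_filt_gens d"
      unfolding gl_filt_gens_def using tens by blast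
  next
    fix x :: "('k, 'n) gl_coord" assume "x \<in> gl_filt_gens d"
    then obtain f g r s where "x = gl_of_mat f * gl_of_gm g" "r + s = d"
      "f \<in> mat_filt r" "g \<in> gm_filt CARD('n) s"
      unfolding gl_filt_gens_def by blast
    then show "x \<in> eta ` ?S"
      by (intro image_eqI[of _ _ "tens f g"]) (simp add: tens, blast)
  qed
  then have "eta ` (?S \<union> ?null) = insert 0 (gl_filt_gens d)"
    by (simp add: image_Un null)
  then show ?thesis
    using eta.span_image[of "?S \<union> ?null"] by (simp add: gl_filt_def mat_gm_filt_def)
qed

lemma gl_filt_gensI:
  assumes "f \<in> mat_filt r" "g \<in> gm_filt CARD('n) s"
  shows "gl_of_mat f * gl_of_gm g \<in> (gl_filt (r + s) :: ('k::field, 'n::finite) gl_coord set)"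
  unfolding gl_filt_eq_span gl_filt_gens_def using assms by (auto intro!: gl.span_base)

text \<open>
  Multiplicativity holds factor by factor, since the polynomials and the Laurent polynomials are
  both filtered multiplicatively. The filtration is exhaustive since it contains every polynomial
  in the entries and \<open>1 / det\<close>, and these generate the localization at the determinant.
\<close>

lemma algebra_filtration_gl_filt:
  "algebra_filtration gl_scale (gl_filt :: nat \<Rightarrow> ('k::field, 'n::finite) gl_coord set)"
proof
  fix d e :: nat and x y :: "('k, 'n) gl_coord"
  show sub: "gl.subspace (gl_filt d :: ('k, 'n) gl_coord set)" for d
    unfolding gl_filt_eq_span by (rule gl.subspace_span)
  show mono: "gl_filt d \<subseteq> (gl_filt e :: ('k, 'n) gl_coord set)" if "d \<le> e" for d e
    unfolding gl_filt_eq_span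
  proof (rule gl.span_mono, unfold gl_filt_gens_def, safe)
    fix f :: "('k, 'n) mat_coord" and g :: "'k gm_coord" and r s
    assume "f \<in> mat_filt r" "g \<in> gm_filt CARD('n) s" "d = r + s"
    with that show "\<exists>f' g' r' s'. gl_of_mat f * gl_of_gm g = gl_of_mat f' * gl_of_gm g'
        \<and> r' + s' = e \<and> f' \<in> mat_filt r' \<and> g' \<in> gm_filt CARD('n) s'"
      by (intro exI[of _ f] exI[of _ g] exI[of _ "e - s"] exI[of _ s])
        (auto intro: mat_filt_mono[of r])
  qed
  have 1: "gl_of_gm 1 = (1 :: ('k, 'n) gl_coord)"
    using gl_of_gm_single[of 0] by simp
  show one: "1 \<in> (gl_filt 0 :: ('k, 'n) gl_coord set)"
  proof -
    have "gl_of_mat 1 * gl_of_gm 1 \<in> (gl_filt (0 + 0) :: ('k, 'n) gl_coord set)"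
      by (rule gl_filt_gensI[OF one_mat_filt one_gm_filt])
    then show ?thesis by (simp only: 1 gl_of_mat_1) simp
  qed
  show mult: "x * y \<in> gl_filt (d + e)" if "x \<in> gl_filt d" "y \<in> gl_filt e" for x y :: "('k, 'n) gl_coord" and d e
  proof (rule gl.span_mult[OF sub _ that[unfolded gl_filt_eq_span]])
    fix x y :: "('k, 'n) gl_coord" assume "x \<in> gl_filt_gens d" "y \<in> gl_filt_gens e"
    then obtain f g r s f' g' r' s' where
      x: "x = gl_of_mat f * gl_of_gm g" "r + s = d" "f \<in> mat_filt r" "g \<in> gm_filt CARD('n) s" and
      y: "y = gl_of_mat f' * gl_of_gm g'" "r' + s' = e" "f' \<in> mat_filt r'" "g' \<in> gm_filt CARD('n) s'"
      unfolding gl_filt_gens_def by blast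
    have "x * y = gl_of_mat (f * f') * gl_of_gm (g * g')"
      by (simp add: x y gl_of_mat_mult gl_of_gm_mult mult_ac)
    moreover have "\<dots> \<in> gl_filt ((r + r') + (s + s'))"
      by (intro gl_filt_gensI mat_filt_mult gm_filt_mult x y)
    moreover have "(r + r') + (s + s') = d + e"
      using x y by simp
    ultimately show "x * y \<in> gl_filt (d + e)" by metis
  qed
  have mat: "\<exists>d. gl_of_mat f \<in> gl_filt d" for f :: "('k, 'n) mat_coord"
  proof -
    obtain r where "f \<in> mat_filt r"
      using mat_filt_exhaustive by blast
    from gl_filt_gensI[OF this one_gm_filt] show ?thesis
      by (auto simp: 1)
  qed
  have "Poly_Mapping.single 1 1 \<in> gm_filt CARD('n) CARD('n)"
    unfolding gm_filt_def by (rule free.span_base) auto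
  from gl_filt_gensI[OF one_mat_filt this]
  have inv: "gl_det_inv \<in> (gl_filt CARD('n) :: ('k, 'n) gl_coord set)"
    by (simp add: gl_of_gm_single gl_of_mat_1)
  \<comment> \<open>Horner's rule for a representative \<open>p\<close>, a polynomial in \<open>1 / det\<close>.\<close>
  have "\<exists>d. abs_gl_coord p \<in> gl_filt d" for p :: "('k, 'n) mat_coord poly"
  proof (induction p)
    case 0
    then show ?case
      using gl.subspace_0[OF sub] unfolding zero_gl_coord_def by blast
  next
    case (pCons a p)
    then obtain d d' where d: "gl_of_mat a \<in> gl_filt d" "abs_gl_coord p \<in> gl_filt d'"
      using mat by blast
    have "abs_gl_coord (pCons a p) = gl_of_mat a + gl_det_inv * abs_gl_coord p"
      by (simp add: gl_of_mat_def gl_det_inv_def times_gl_coord.abs_eq plus_gl_coord.abs_eq)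
    also have "\<dots> \<in> gl_filt (d + (CARD('n) + d'))"
      by (intro gl.subspace_add[OF sub] subsetD[OF mono d(1)] subsetD[OF mono mult[OF inv d(2)]]) auto
    finally show ?case by blast
  qed
  then show "\<exists>d. x \<in> gl_filt d"
    by (rule gl_coord.abs_induct)
qed

section \<open>The filtrations of an embedded group scheme\<close>

text \<open>
  All properties pass to the image under an algebra homomorphism; surjectivity is what
  makes the image filtration exhaustive.
\<close>

lemma algebra_filtration_emb_filt:
  fixes scale :: "'k::field \<Rightarrow> 'a::comm_ring_1 \<Rightarrow> 'a"
    and \<phi> :: "('k, 'n::finite) gl_coord \<Rightarrow> 'a"
  assumes alg: "comm_algebra scale" and hom: "algebra_hom gl_scale scale \<phi>" and surj: "surj \<phi>"
  shows "algebra_filtration scale (emb_filt \<phi>)"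
proof -
  interpret comm_algebra scale
    by (rule alg)
  interpret gl: algebra_filtration gl_scale "gl_filt :: nat \<Rightarrow> ('k, 'n) gl_coord set"
    by (rule algebra_filtration_gl_filt)
  interpret \<phi>: Vector_Spaces.linear gl_scale scale \<phi>
    using hom by (simp add: algebra_hom_def)
  have mult: "\<phi> (x * y) = \<phi> x * \<phi> y" and one: "\<phi> 1 = 1" for x y
    using hom by (simp_all add: algebra_hom_def)
  show ?thesis
  proof
    fix d e :: nat and x y
    show "subspace (emb_filt \<phi> d)"
      unfolding emb_filt_def by (rule \<phi>.subspace_image[OF gl.subspace_filt])
    show "emb_filt \<phi> d \<subseteq> emb_filt \<phi> e" if "d \<le> e"
      unfolding emb_filt_def using gl.filt_mono[OF that] by (rule image_mono)
    show "1 \<in> emb_filt \<phi> 0"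
      unfolding emb_filt_def using gl.one_filt one by force
    show "x * y \<in> emb_filt \<phi> (d + e)" if "x \<in> emb_filt \<phi> d" "y \<in> emb_filt \<phi> e"
      using that gl.mult_filt unfolding emb_filt_def by (auto simp flip: mult)
    show "\<exists>d. x \<in> emb_filt \<phi> d"
      unfolding emb_filt_def using gl.exhaustive surj by (metis imageI surj_def)
  qed
qed

context algebra_filtration
begin

lemma monomial_filt:
  fixes \<phi> :: "('k, 'n::finite) gl_coord \<Rightarrow> 'a"
  assumes hom: "algebra_hom gl_scale scale \<phi>" and var: "\<And>i j. \<phi> (gl_var i j) \<in> E c"
  shows "\<phi> (gl_of_mat (Poly_Mapping.single m 1)) \<in> E (c * (\<Sum>v\<in>UNIV. Poly_Mapping.lookup m v))"
proof (induction "\<Sum>v\<in>UNIV. Poly_Mapping.lookup m v" arbitrary: m)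
  case 0
  have "Poly_Mapping.lookup m v = 0" for v
    using member_le_sum[of v UNIV "Poly_Mapping.lookup m"] 0 by simp
  then have "m = 0"
    by (intro poly_mapping_eqI) (simp only: lookup_zero)
  then show ?case
    using hom by (simp add: algebra_hom_def gl_of_mat_1 one_filt)
next
  case (Suc n)
  then obtain v where v: "Poly_Mapping.lookup m v > 0"
    by (metis gr0I sum.neutral nat.distinct(1))
  define m' where "m' = m - Poly_Mapping.single v 1"
  have m: "m = Poly_Mapping.single v 1 + m'"
    using v by (intro poly_mapping_eqI) (auto simp: m'_def lookup_add lookup_minus lookup_single when_def)
  have deg: "(\<Sum>w\<in>UNIV. Poly_Mapping.lookup m w) = Suc (\<Sum>w\<in>UNIV. Poly_Mapping.lookup m' w)"
    by (simp add: m lookup_add sum.distrib lookup_single when_def)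
  have single: "Poly_Mapping.single m 1 = mat_var (fst v) (snd v) * Poly_Mapping.single m' (1 :: 'k)"
    unfolding m by (simp add: mat_var_def mult_single)
  have "\<phi> (gl_of_mat (Poly_Mapping.single m 1))
      = \<phi> (gl_var (fst v) (snd v)) * \<phi> (gl_of_mat (Poly_Mapping.single m' 1))"
    unfolding single gl_of_mat_mult using hom by (simp only: algebra_hom_def)
  also have "\<dots> \<in> E (c + c * (\<Sum>w\<in>UNIV. Poly_Mapping.lookup m' w))"
    using Suc deg by (intro mult_filt var) simp
  finally show ?case by (simp add: deg)
qed

text \<open>
  A monomial of degree at most \<open>r\<close> is mapped to degree \<open>c \<cdot> r\<close>. The \<open>i\<close>-th power of \<open>1 / det\<close> has weight
  \<open>N \<cdot> \<bar>i\<bar>\<close>, where \<open>N \<ge> 1\<close>; it is a product of only \<open>\<bar>i\<bar>\<close> generators, so that the same constant \<open>c\<close>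
  serves for it.
\<close>

lemma emb_filt_subset_of_generators:
  fixes \<phi> :: "('k, 'n::finite) gl_coord \<Rightarrow> 'a"
  assumes hom: "algebra_hom gl_scale scale \<phi>"
    and var: "\<And>i j. \<phi> (gl_var i j) \<in> E c"
    and det: "\<phi> (gl_of_mat generic_det) \<in> E c" "\<phi> gl_det_inv \<in> E c"
  shows "emb_filt \<phi> d \<subseteq> E (c * d)"
proof -
  interpret \<phi>: Vector_Spaces.linear gl_scale scale \<phi>
    using hom by (simp add: algebra_hom_def)
  have one: "\<phi> 1 = 1" and mult: "\<phi> (x * y) = \<phi> x * \<phi> y" for x y
    using hom by (simp_all add: algebra_hom_def)
  have power: "\<phi> (x ^ n) = \<phi> x ^ n" for x n
    by (induction n) (simp_all add: one mult)
  have mat: "\<phi> (gl_of_mat f) \<in> E (c * r)" if "f \<in> mat_filt r" for f r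
  proof -
    let ?l = "Poly_Mapping.lookup f" and ?s = "\<lambda>m. Poly_Mapping.single m (1 :: 'k)"
    have "f = (\<Sum>m\<in>Poly_Mapping.keys f. free_scale (?l m) (?s m))"
      using poly_mapping_eq_sum_single[of f] by simp
    then have "\<phi> (gl_of_mat f) = \<phi> (gl_of_mat (\<Sum>m\<in>Poly_Mapping.keys f. free_scale (?l m) (?s m)))"
      by simp
    also have "\<dots> = (\<Sum>m\<in>Poly_Mapping.keys f. scale (?l m) (\<phi> (gl_of_mat (?s m))))"
      by (simp only: gl_of_mat.sum gl_of_mat.scale \<phi>.sum \<phi>.scale)
    also have "\<dots> \<in> E (c * r)"
    proof (intro subspace_sum subspace_scale subspace_filt)
      fix m assume "m \<in> Poly_Mapping.keys f"
      then have "(\<Sum>v\<in>UNIV. Poly_Mapping.lookup m v) \<le> r"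
        using that by (simp add: mat_filt_def)
      then show "\<phi> (gl_of_mat (?s m)) \<in> E (c * r)"
        by (intro filt_monoD[OF monomial_filt[OF hom var]] mult_left_mono) simp_all
    qed
    finally show ?thesis .
  qed
  have gm: "\<phi> (gl_of_gm g) \<in> E (c * s)" if "g \<in> gm_filt CARD('n) s" for g s
    using that unfolding gm_filt_def
  proof (rule free.span_induct)
    show "free.subspace {g. \<phi> (gl_of_gm g) \<in> E (c * s)}"
      using gl_of_gm.subspace_vimage[OF \<phi>.subspace_vimage[OF subspace_filt]] by (simp add: vimage_def)
  next
    fix g assume "g \<in> {Poly_Mapping.single i (1 :: 'k) |i. int CARD('n) * \<bar>i\<bar> \<le> int s}"
    then obtain i where g: "g = Poly_Mapping.single i 1" and i: "int CARD('n) * \<bar>i\<bar> \<le> int s"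
      by blast
    have "\<bar>i\<bar> \<le> int CARD('n) * \<bar>i\<bar>"
      using mult_right_mono[of 1 "int CARD('n)" "\<bar>i\<bar>"] by (simp add: Suc_leI)
    then have "nat \<bar>i\<bar> \<le> s"
      using i by linarith
    then have "c * nat i \<le> c * s" "c * nat (- i) \<le> c * s"
      by (auto intro!: mult_left_mono)
    then show "\<phi> (gl_of_gm g) \<in> E (c * s)"
      unfolding g gl_of_gm_single
      by (auto simp: power intro: filt_monoD[OF power_filt] det)
  qed
  have "gl_filt_gens d \<subseteq> \<phi> -` E (c * d)"
    unfolding gl_filt_gens_def
    by (auto simp: mult distrib_left intro!: mult_filt mat gm)
  then have "gl_filt d \<subseteq> \<phi> -` E (c * d)"
    unfolding gl_filt_eq_span by (intro gl.span_minimal \<phi>.subspace_vimage subspace_filt)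
  then show ?thesis
    by (auto simp: emb_filt_def)
qed

lemma emb_filt_subset:
  fixes \<phi> :: "('k, 'n::finite) gl_coord \<Rightarrow> 'a"
  assumes "algebra_hom gl_scale scale \<phi>"
  shows "\<exists>c>0. \<forall>d. emb_filt \<phi> d \<subseteq> E (c * d)"
proof -
  have "finite (range (\<lambda>(i, j). \<phi> (gl_var i j)) \<union> {\<phi> (gl_of_mat generic_det), \<phi> gl_det_inv})"
    by simp
  then obtain c where "c > 0"
    and c: "range (\<lambda>(i, j). \<phi> (gl_var i j)) \<union> {\<phi> (gl_of_mat generic_det), \<phi> gl_det_inv} \<subseteq> E c"
    using finite_subset_filt by meson
  have "emb_filt \<phi> d \<subseteq> E (c * d)" for d
    by (rule emb_filt_subset_of_generators[OF assms]) (use c in auto)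
  then show ?thesis using \<open>c > 0\<close> by blast
qed

end

theorem proposition3p8:
  fixes p :: nat
    and G :: "('k::field, 'a::comm_ring_1) group_scheme"
    and \<phi> :: "('k, 'n::finite) gl_coord \<Rightarrow> 'a"
    and \<phi>' :: "('k, 'm::finite) gl_coord \<Rightarrow> 'a"
  assumes "CHAR('k) = p" and "p > 0"
    and "affine_group_scheme G" and "finite_type G"
    and "closed_embedding G GL \<phi>" and "closed_embedding G GL \<phi>'"
  shows "\<exists>c c' :: nat. c > 0 \<and> c' > 0 \<and>
    (\<forall>d. emb_filt \<phi> d \<subseteq> emb_filt \<phi>' (c * d) \<and> emb_filt \<phi>' d \<subseteq> emb_filt \<phi> (c' * d))"
proof -
  have alg: "comm_algebra (scal G)"
    using assms(3) by (rule affine_group_scheme.algebra)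
  have hom: "algebra_hom gl_scale (scal G) \<phi>" "algebra_hom gl_scale (scal G) \<phi>'"
    and surj: "surj \<phi>" "surj \<phi>'"
    using assms(5,6) by (simp_all add: closed_embedding_def group_scheme_morphism_def GL_def)
  interpret F: algebra_filtration "scal G" "emb_filt \<phi>"
    by (rule algebra_filtration_emb_filt[OF alg hom(1) surj(1)])
  interpret F': algebra_filtration "scal G" "emb_filt \<phi>'"
    by (rule algebra_filtration_emb_filt[OF alg hom(2) surj(2)])
  show ?thesis
    using F'.emb_filt_subset[OF hom(1)] F.emb_filt_subset[OF hom(2)] by blast
qed

end
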